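(* Let $(\mathbb{H},\cdot)$ be a nonempty semigroup. Then $+_{\mathbb{H}}$ and $*$ are operations $\mathbf{R}(\mathbb{H})\times\mathbf{R}(\mathbb{H})\to\mathbf{R}(\mathbb{H})$, and the triple $(\mathbf{R}(\mathbb{H}),+_{\mathbb{H}},* )$ is a ring.
   Context: Rings are associative and are not required to have a unit or to be commutative. For a nonempty semigroup $(\mathbb{H},\cdot)$, $sums(\mathbb{H})$ is the set of all finite formal signed sums (sequences of signed elements) $\langle \pm_1 x_1 \pm_2 x_2 \cdots \pm_N x_N\rangle$ with $N\in\mathbb{N}_0$, each sign $\pm_i\in\{+,-\}$, and $x_1,\dots,x_N\in\mathbb{H}$ not necessarily distinct; $N$ is the length and the $\pm_i x_i$ are the entries. For $N=0$ this is the empty sum $\langle\,\rangle$. Relation $\approx_1$: $x\approx_1 y$ if $y$ is obtained from $x$ by deleting a pair of entries $+h,-h$ for some $h\in\mathbb{H}$ (so if $x$ has length $N$, $y$ has length $N-2$). Relation $\approx_2$: $x\approx_2 z$ if $z$ is obtained from $x$ by permuting the entries (each with its sign). Let $\cong$ be the smallest equivalence relation on $sums(\mathbb{H})$ containing $\approx_1$ and $\approx_2$. Put $\mathbf{R}(\mathbb{H}):=sums(\mathbb{H})/{\cong}$ and $0_{\mathbf{R}(\mathbb{H})}:=[\langle\,\rangle]_{/\cong}$. Operations, defined via representatives $x=\langle\sum_{i=1}^N\pm_{i,1}x_i\rangle$, $y=\langle\sum_{j=1}^K\pm_{j,2}y_j\rangle$: - $x+_{\mathbb{H}}y:=\left[\left\langle\sum_{l=1}^{\max\{N,K\}}\pm_{l,1}x_l\pm_{l,2}y_l\right\rangle\right]_{/\cong}$,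 where for $K<l\le N$ only the entry $\pm_{l,1}x_l$ is present, and for $N<l\le K$ only the entry $\pm_{l,2}y_l$ is present. - $x*y:=\left[\left\langle\sum_{i=1}^N\sum_{j=1}^K\pm_{i,j,*}\,x_i\cdot y_j\right\rangle\right]_{/\cong}$, where $\pm_{i,j,*}$ is $+$ if the signs $\pm_{i,1},\pm_{j,2}$ are equal and $-$ if they are different; and $x*0_{\mathbf{R}(\mathbb{H})}:=0_{\mathbf{R}(\mathbb{H})}=:0_{\mathbf{R}(\mathbb{H})}*x$. *)

theory Defs
  imports "HOL-Algebra.Ring" "HOL-Combinatorics.List_Permutation"
begin

locale carrier_semigroup =
  fixes H :: "'a set" and f :: "'a \<Rightarrow> 'a \<Rightarrow> 'a"
  assumes closed: "\<lbrakk>x \<in> H; y \<in> H\<rbrakk> \<Longrightarrow> f x y \<in> H"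
    and assoc: "\<lbrakk>x \<in> H; y \<in> H; z \<in> H\<rbrakk> \<Longrightarrow> f (f x y) z = f x (f y z)"

text \<open>
  Associative rings, not required to be commutative or to have a unit. The \<open>one\<close> field
  of the HOL-Algebra record is left unconstrained.
\<close>

locale rng = abelian_group R for R (structure) +
  assumes m_closed: "\<lbrakk>x \<in> carrier R; y \<in> carrier R\<rbrakk> \<Longrightarrow> x \<otimes> y \<in> carrier R"
    and m_assoc: "\<lbrakk>x \<in> carrier R; y \<in> carrier R; z \<in> carrier R\<rbrakk>
      \<Longrightarrow> (x \<otimes> y) \<otimes> z = x \<otimes> (y \<otimes> z)"
    and l_distr: "\<lbrakk>x \<in> carrier R; y \<in> carrier R; z \<in> carrier R\<rbrakk>
      \<Longrightarrow> (x \<oplus> y) \<otimes> z = x \<otimes> z \<oplus> y \<otimes> z"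
    and r_distr: "\<lbrakk>x \<in> carrier R; y \<in> carrier R; z \<in> carrier R\<rbrakk>
      \<Longrightarrow> z \<otimes> (x \<oplus> y) = z \<otimes> x \<oplus> z \<otimes> y"

datatype sign = Positive | Negative

type_synonym 'a signed_sum = "(sign \<times> 'a) list"

definition sums :: "'a set \<Rightarrow> 'a signed_sum set" where
  "sums H = lists (UNIV \<times> H)"

definition approx1 :: "'a set \<Rightarrow> ('a signed_sum \<times> 'a signed_sum) set" where
  "approx1 H = {(x, y). x \<in> sums H \<and>
     (\<exists>u v w s t h. s \<noteq> t \<and> x = u @ (s, h) # v @ (t, h) # w \<and> y = u @ v @ w)}"

definition approx2 :: "'a set \<Rightarrow> ('a signed_sum \<times> 'a signed_sum) set" where
  "approx2 H = {(x, z). x \<in> sums H \<and> x <~~> z}"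

definition cong_sums :: "'a set \<Rightarrow> ('a signed_sum \<times> 'a signed_sum) set" where
  "cong_sums H = \<Inter>{E. equiv (sums H) E \<and> approx1 H \<subseteq> E \<and> approx2 H \<subseteq> E}"

definition R_carrier :: "'a set \<Rightarrow> 'a signed_sum set set" where
  "R_carrier H = sums H // cong_sums H"

definition R_zero :: "'a set \<Rightarrow> 'a signed_sum set" where
  "R_zero H = cong_sums H `` {[]}"

text \<open>
  \<open>splice\<close> alternates the entries of its arguments and then appends what is left of the
  longer one.
\<close>

definition add_rep :: "'a set \<Rightarrow> 'a signed_sum \<Rightarrow> 'a signed_sum \<Rightarrow> 'a signed_sum set" where
  "add_rep H x y = cong_sums H `` {splice x y}"

text \<open>
  If one of the representatives is the empty sum, then so is the double sum below; this is
  the convention that a product with \<open>R_zero H\<close> is \<open>R_zero H\<close>.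
\<close>

definition mult_rep ::
  "'a set \<Rightarrow> ('a \<Rightarrow> 'a \<Rightarrow> 'a) \<Rightarrow> 'a signed_sum \<Rightarrow> 'a signed_sum \<Rightarrow> 'a signed_sum set" where
  "mult_rep H f x y = cong_sums H ``
     {[(if s = t then Positive else Negative, f a b). (s, a) \<leftarrow> x, (t, b) \<leftarrow> y]}"

text \<open>
  The operations on classes take the union over all choices of representatives. This is a
  single class exactly when the result does not depend on the representatives.
\<close>

definition R_add :: "'a set \<Rightarrow> 'a signed_sum set \<Rightarrow> 'a signed_sum set \<Rightarrow> 'a signed_sum set" where
  "R_add H X Y = (\<Union>x\<in>X. \<Union>y\<in>Y. add_rep H x y)"

definition R_mult ::
  "'a set \<Rightarrow> ('a \<Rightarrow> 'a \<Rightarrow> 'a) \<Rightarrow> 'a signed_sum set \<Rightarrow> 'a signed_sum set \<Rightarrow> 'a signed_sum set" where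
  "R_mult H f X Y = (\<Union>x\<in>X. \<Union>y\<in>Y. mult_rep H f x y)"

text \<open>The \<open>one\<close> field is a dummy; \<open>rng\<close> does not refer to it.\<close>

definition R_ring :: "'a set \<Rightarrow> ('a \<Rightarrow> 'a \<Rightarrow> 'a) \<Rightarrow> 'a signed_sum set ring" where
  "R_ring H f = \<lparr>carrier = R_carrier H, monoid.mult = R_mult H f, one = undefined,
     zero = R_zero H, add = R_add H\<rparr>"

end

(*
  Every g :: 'a => int extends to signed sums by g(<+-x_1 ... +-x_N>) = +-g(x_1) ... +-g(x_N).
  Two signed sums over H are congruent iff all these extensions agree on them: one direction
  is clear on generators, and a sum on which every extension vanishes can be deleted pair by
  pair. Since the extensions turn formal addition into addition, and the double sum into an
  iterated sum, well-definedness and the ring axioms become identities between integers.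
*)

theory Submission
  imports Defs
begin

section \<open>Evaluation of signed sums in the integers\<close>

fun sign_int :: "sign \<Rightarrow> int" where
  "sign_int Positive = 1"
| "sign_int Negative = -1"

definition signed_eval :: "('a \<Rightarrow> int) \<Rightarrow> 'a signed_sum \<Rightarrow> int" where
  "signed_eval g x = (\<Sum>(s, a)\<leftarrow>x. sign_int s * g a)"

definition sign_mult :: "sign \<Rightarrow> sign \<Rightarrow> sign" where
  "sign_mult s t = (if s = t then Positive else Negative)"

definition mult_list :: "('a \<Rightarrow> 'a \<Rightarrow> 'a) \<Rightarrow> 'a signed_sum \<Rightarrow> 'a signed_sum \<Rightarrow> 'a signed_sum" where
  "mult_list f x y = [(sign_mult s t, f a b). (s, a) \<leftarrow> x, (t, b) \<leftarrow> y]"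

text \<open>Represents the additive inverse. It also supplies the null sum
  \<open>uminus_list y @ y\<close> that links two sums with equal evaluations.\<close>

definition uminus_list :: "'a signed_sum \<Rightarrow> 'a signed_sum" where
  "uminus_list = map (apfst (sign_mult Negative))"

lemma sign_int_mult [simp]: "sign_int (sign_mult s t) = sign_int s * sign_int t"
  by (cases s; cases t) (simp_all add: sign_mult_def)

lemma sign_int_cancel: "s \<noteq> t \<Longrightarrow> sign_int s + sign_int t = 0"
  by (cases s; cases t) simp_all

lemma sign_int_square: "sign_int s * sign_int s = 1"
  by (cases s) simp_all

lemma signed_eval_Nil [simp]: "signed_eval g [] = 0"
  and signed_eval_Cons [simp]: "signed_eval g ((s, a) # x) = sign_int s * g a + signed_eval g x"
  and signed_eval_append [simp]: "signed_eval g (x @ y) = signed_eval g x + signed_eval g y"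
  by (simp_all add: signed_eval_def)

lemma signed_eval_perm:
  assumes "x <~~> y"
  shows "signed_eval g x = signed_eval g y"
proof -
  have "signed_eval g z = (\<Sum>(s, a)\<in>#mset z. sign_int s * g a)" for z
    unfolding signed_eval_def by (metis mset_map sum_mset_sum_list)
  with assms show ?thesis by simp
qed

lemma signed_eval_splice [simp]: "signed_eval g (splice x y) = signed_eval g x + signed_eval g y"
  by (induction x y rule: splice.induct) (auto split: prod.splits)

lemma signed_eval_uminus_list [simp]: "signed_eval g (uminus_list x) = - signed_eval g x"
  by (induction x) (auto simp: uminus_list_def)

text \<open>Serves distributivity with the sum as right factor: there the inner evaluation of a
  splice turns into a pointwise sum of two functions.\<close>

lemma signed_eval_add: "signed_eval (\<lambda>a. g a + h a) x = signed_eval g x + signed_eval h x"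
  by (induction x) (auto simp: algebra_simps)

text \<open>Signs multiply, so the row belonging to a fixed entry \<open>(s, a)\<close> of
  \<open>x\<close> contributes \<open>sign_int s\<close> times an evaluation of
  \<open>y\<close>.\<close>

lemma signed_eval_mult_list [simp]:
  "signed_eval g (mult_list f x y) = signed_eval (\<lambda>a. signed_eval (\<lambda>b. g (f a b)) y) x"
proof (induction x)
  case (Cons p x)
  obtain s a where p: "p = (s, a)" by (cases p)
  have "signed_eval g (map (\<lambda>(t, b). (sign_mult s t, f a b)) y)
      = sign_int s * signed_eval (\<lambda>b. g (f a b)) y"
    by (induction y) (auto simp: algebra_simps)
  with Cons p show ?case by (simp add: mult_list_def)
qed (simp add: mult_list_def)

section \<open>Membership in \<open>sums H\<close> and its closure properties\<close>

lemma mem_sums_iff: "x \<in> sums H \<longleftrightarrow> snd ` set x \<subseteq> H"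
  by (auto simp: sums_def)

lemma Nil_in_sums [simp]: "[] \<in> sums H"
  and Cons_in_sums [simp]: "(s, a) # x \<in> sums H \<longleftrightarrow> a \<in> H \<and> x \<in> sums H"
  and append_in_sums [simp]: "x @ y \<in> sums H \<longleftrightarrow> x \<in> sums H \<and> y \<in> sums H"
  by (auto simp: mem_sums_iff)

lemma perm_in_sums: "x <~~> y \<Longrightarrow> x \<in> sums H \<Longrightarrow> y \<in> sums H"
  by (metis mem_sums_iff mset_eq_setD)

lemma splice_in_sums: "x \<in> sums H \<Longrightarrow> y \<in> sums H \<Longrightarrow> splice x y \<in> sums H"
  by (induction x y rule: splice.induct) auto

lemma uminus_list_in_sums: "x \<in> sums H \<Longrightarrow> uminus_list x \<in> sums H"
  by (auto simp: mem_sums_iff uminus_list_def)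

lemma mult_list_in_sums:
  assumes "carrier_semigroup H f" "x \<in> sums H" "y \<in> sums H"
  shows "mult_list f x y \<in> sums H"
  using assms by (force simp: mem_sums_iff mult_list_def intro: carrier_semigroup.closed)

section \<open>The congruence and its description by evaluations\<close>

lemma
  shows cong_sums_perm: "x \<in> sums H \<Longrightarrow> x <~~> y \<Longrightarrow> (x, y) \<in> cong_sums H"
    and cong_sums_cancel:
      "\<lbrakk>u @ (s, h) # v @ (t, h) # w \<in> sums H; s \<noteq> t\<rbrakk>
        \<Longrightarrow> (u @ (s, h) # v @ (t, h) # w, u @ v @ w) \<in> cong_sums H"
  by (fastforce simp: cong_sums_def approx1_def approx2_def)+

lemma cong_sums_refl: "x \<in> sums H \<Longrightarrow> (x, x) \<in> cong_sums H"
  by (simp add: cong_sums_perm)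

lemma cong_sums_sym: "(x, y) \<in> cong_sums H \<Longrightarrow> (y, x) \<in> cong_sums H"
  by (auto simp: cong_sums_def equiv_def dest: symD)

lemma cong_sums_trans:
  "(x, y) \<in> cong_sums H \<Longrightarrow> (y, z) \<in> cong_sums H \<Longrightarrow> (x, z) \<in> cong_sums H"
  unfolding cong_sums_def equiv_def by (blast dest: transD)

text \<open>Evaluating at the indicator function of \<open>h\<close> counts the occurrences of
  \<open>h\<close> with their signs; if only \<open>s\<close> occurs, nothing can cancel.\<close>

lemma signed_eval_one_sign:
  assumes "\<And>t. (t, h) \<in> set x \<Longrightarrow> t = s"
  shows "0 \<le> sign_int s * signed_eval (\<lambda>a. of_bool (a = h)) x"
  using assms
proof (induction x)
  case (Cons p x)
  then have "0 \<le> sign_int s * signed_eval (\<lambda>a. of_bool (a = h)) x" by simp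
  moreover have "fst p = s" if "snd p = h" using Cons.prems that by (cases p) auto
  ultimately show ?case
    by (cases p) (auto simp: distrib_left sign_int_square)
qed simp

text \<open>Each deletion shortens \<open>z\<close> by two entries. Carrying the suffix
  \<open>x\<close> through the induction replaces a separate proof that the congruence respects
  concatenation.\<close>

lemma null_append_cong:
  assumes "z \<in> sums H" "x \<in> sums H" "\<And>g. signed_eval g z = 0"
  shows "(z @ x, x) \<in> cong_sums H"
  using assms
proof (induction z rule: length_induct)
  case (1 z)
  show ?case
  proof (cases z)
    case Nil
    with 1 show ?thesis by (simp add: cong_sums_refl)
  next
    case (Cons p z')
    obtain s h where p: "p = (s, h)" by (cases p)
    \<comment> \<open>The first entry needs a partner of opposite sign: otherwise, at the indicator
      of \<open>h\<close> and after multiplication by \<open>sign_int s\<close>, it contributes 1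
      and the rest at least 0, while the total is 0.\<close>
    have "\<exists>t. (t, h) \<in> set z' \<and> s \<noteq> t"
    proof (rule ccontr)
      assume "\<not> ?thesis"
      then have "0 \<le> sign_int s * signed_eval (\<lambda>a. of_bool (a = h)) z'"
        by (intro signed_eval_one_sign) auto
      moreover have "sign_int s * signed_eval (\<lambda>a. of_bool (a = h)) z = 0"
        using 1 by simp
      ultimately show False
        by (simp add: Cons p distrib_left sign_int_square)
    qed
    then obtain t v w where t: "s \<noteq> t" and z': "z' = v @ (t, h) # w"
      by (meson split_list)
    have z: "z = (s, h) # v @ (t, h) # w" by (simp add: Cons p z')
    have null: "signed_eval g (v @ w) = 0" for g
    proof -
      have "(sign_int s + sign_int t) * g h + signed_eval g (v @ w) = signed_eval g z"
        by (simp add: z algebra_simps)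
      with t 1 show ?thesis by (simp add: sign_int_cancel)
    qed
    have "(v @ w @ x, x) \<in> cong_sums H"
      using "1.IH"[rule_format, of "v @ w"] "1.prems" null by (simp add: z)
    moreover have "(z @ x, v @ w @ x) \<in> cong_sums H"
      using cong_sums_cancel[of "[]" s h v t "w @ x" H] 1 t by (simp add: z)
    ultimately show ?thesis by (rule cong_sums_trans[rotated])
  qed
qed

lemma cong_sums_iff:
  "(x, y) \<in> cong_sums H \<longleftrightarrow>
    x \<in> sums H \<and> y \<in> sums H \<and> (\<forall>g. signed_eval g x = signed_eval g y)"
proof
  let ?E = "{(x, y). x \<in> sums H \<and> y \<in> sums H \<and> (\<forall>g. signed_eval g x = signed_eval g y)}"
  \<comment> \<open>It suffices that \<open>?E\<close> belongs to the family whose intersection is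
    \<open>cong_sums H\<close>. For \<open>approx1\<close>, the deleted entries contribute
    \<open>(sign_int s + sign_int t) * g h\<close>, which is 0.\<close>
  have "equiv (sums H) ?E"
    by (auto intro!: equivI refl_onI symI transI)
  moreover have "approx1 H \<subseteq> ?E"
    by (auto simp: approx1_def distrib_right[symmetric] add.assoc[symmetric]
          add.left_commute[of "sign_int t * b" for t b] sign_int_cancel)
  moreover have "approx2 H \<subseteq> ?E"
    by (auto simp: approx2_def intro: perm_in_sums signed_eval_perm)
  ultimately have "cong_sums H \<subseteq> ?E"
    unfolding cong_sums_def by blast
  then show "(x, y) \<in> cong_sums H \<Longrightarrow>
      x \<in> sums H \<and> y \<in> sums H \<and> (\<forall>g. signed_eval g x = signed_eval g y)"
    by blast
next
  assume *: "x \<in> sums H \<and> y \<in> sums H \<and> (\<forall>g. signed_eval g x = signed_eval g y)"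
  \<comment> \<open>Insert a null sum in front of \<open>x\<close>, permute, then delete
    \<open>x @ uminus_list y\<close>, which is null because \<open>x\<close> and \<open>y\<close>
    have equal evaluations.\<close>
  then have "(x, (uminus_list y @ y) @ x) \<in> cong_sums H"
    by (intro cong_sums_sym[OF null_append_cong]) (auto simp: uminus_list_in_sums)
  moreover have "((uminus_list y @ y) @ x, (x @ uminus_list y) @ y) \<in> cong_sums H"
    using * by (intro cong_sums_perm) (auto simp: uminus_list_in_sums)
  moreover have "((x @ uminus_list y) @ y, y) \<in> cong_sums H"
    using * by (intro null_append_cong) (auto simp: uminus_list_in_sums)
  ultimately show "(x, y) \<in> cong_sums H"
    by (blast intro: cong_sums_trans)
qed

text \<open>Equality of all evaluations is visibly an equivalence relation on
  \<open>sums H\<close>.\<close>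

lemma equiv_cong_sums: "equiv (sums H) (cong_sums H)"
  by (auto intro!: equivI refl_onI symI transI simp: cong_sums_iff)

section \<open>Operations on congruence classes\<close>

abbreviation sum_class :: "'a set \<Rightarrow> 'a signed_sum \<Rightarrow> 'a signed_sum set" where
  "sum_class H x \<equiv> cong_sums H `` {x}"

text \<open>Reduces an equation between classes to integer identities; the independence of
  representatives and the ring axioms are obtained through it.\<close>

lemma sum_class_eqI:
  assumes "x \<in> sums H" "y \<in> sums H" "\<And>g. signed_eval g x = signed_eval g y"
  shows "sum_class H x = sum_class H y"
  using assms by (intro equiv_class_eq[OF equiv_cong_sums]) (simp add: cong_sums_iff)

lemma sum_class_in_carrier: "x \<in> sums H \<Longrightarrow> sum_class H x \<in> R_carrier H"
  by (simp add: R_carrier_def quotientI)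

lemma R_carrier_cases:
  assumes "X \<in> R_carrier H"
  obtains x where "x \<in> sums H" "X = sum_class H x"
  using assms by (auto simp: R_carrier_def elim: quotientE)

lemma mult_rep_eq: "mult_rep H f x y = sum_class H (mult_list f x y)"
  by (simp add: mult_rep_def mult_list_def sign_mult_def)

lemma congruent2_add_rep: "congruent2 (cong_sums H) (cong_sums H) (add_rep H)"
  by (auto simp: congruent2_def add_rep_def cong_sums_iff splice_in_sums intro!: sum_class_eqI)

lemma congruent2_mult_rep:
  assumes "carrier_semigroup H f"
  shows "congruent2 (cong_sums H) (cong_sums H) (mult_rep H f)"
  unfolding congruent2_def
proof (clarify, unfold mult_rep_eq, rule sum_class_eqI)
  fix x x' y y' g
  assume xy: "(x, x') \<in> cong_sums H" "(y, y') \<in> cong_sums H"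
  then show "mult_list f x y \<in> sums H" "mult_list f x' y' \<in> sums H"
    using assms by (simp_all add: cong_sums_iff mult_list_in_sums)
  \<comment> \<open>In the iterated sum, \<open>y\<close> is exchanged for \<open>y'\<close> at the
    function \<open>\<lambda>b. g (f a b)\<close> for each \<open>a\<close>; then \<open>x\<close>
    is exchanged for \<open>x'\<close> at the resulting function of \<open>a\<close>.\<close>
  show "signed_eval g (mult_list f x y) = signed_eval g (mult_list f x' y')"
    using xy by (simp add: cong_sums_iff)
qed

text \<open>Independence of representatives collapses the union in \<open>R_add\<close> to a single
  class.\<close>

lemma R_add_class:
  "x \<in> sums H \<Longrightarrow> y \<in> sums H
    \<Longrightarrow> R_add H (sum_class H x) (sum_class H y) = sum_class H (splice x y)"
  using UN_equiv_class2[OF equiv_cong_sums equiv_cong_sums congruent2_add_rep]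
  by (simp add: R_add_def add_rep_def)

lemma R_mult_class:
  "carrier_semigroup H f \<Longrightarrow> x \<in> sums H \<Longrightarrow> y \<in> sums H
    \<Longrightarrow> R_mult H f (sum_class H x) (sum_class H y) = sum_class H (mult_list f x y)"
  using UN_equiv_class2[OF equiv_cong_sums equiv_cong_sums congruent2_mult_rep]
  by (simp add: R_mult_def mult_rep_eq)

lemma R_add_closed: "X \<in> R_carrier H \<Longrightarrow> Y \<in> R_carrier H \<Longrightarrow> R_add H X Y \<in> R_carrier H"
  by (elim R_carrier_cases) (simp add: R_add_class sum_class_in_carrier splice_in_sums)

lemma R_mult_closed:
  assumes "carrier_semigroup H f" "X \<in> R_carrier H" "Y \<in> R_carrier H"
  shows "R_mult H f X Y \<in> R_carrier H"
  using assms(2,3)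
  by (elim R_carrier_cases)
    (simp add: R_mult_class sum_class_in_carrier mult_list_in_sums assms(1))

section \<open>The ring axioms\<close>

lemma signed_eval_cong:
  assumes "x \<in> sums H" "\<And>a. a \<in> H \<Longrightarrow> g a = h a"
  shows "signed_eval g x = signed_eval h x"
  using assms by (induction x) auto

text \<open>Both sides unfold to triple evaluations, of \<open>g (f (f a b) c)\<close> and of
  \<open>g (f a (f b c))\<close>. As \<open>f\<close> is associative only on \<open>H\<close>, the
  congruence rule must supply that \<open>a\<close>, \<open>b\<close>, \<open>c\<close> lie in
  \<open>H\<close>.\<close>

lemma signed_eval_mult_list_assoc:
  assumes "carrier_semigroup H f" "x \<in> sums H" "y \<in> sums H" "z \<in> sums H"
  shows "signed_eval g (mult_list f (mult_list f x y) z)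
    = signed_eval g (mult_list f x (mult_list f y z))"
  using assms
  by (simp add: carrier_semigroup.assoc cong: signed_eval_cong)

lemma abelian_group_R_ring: "abelian_group (R_ring H f)"
proof (rule abelian_groupI; simp add: R_ring_def R_zero_def sum_class_in_carrier R_add_closed)
  fix X Y Z
  assume X: "X \<in> R_carrier H"
  then obtain x where x: "x \<in> sums H" "X = sum_class H x" by (rule R_carrier_cases)
  show "R_add H (sum_class H []) X = X"
    using x by (simp add: R_add_class)
  show "\<exists>W\<in>R_carrier H. R_add H W X = sum_class H []"
    using x by (intro bexI[of _ "sum_class H (uminus_list x)"])
      (simp_all add: R_add_class sum_class_in_carrier uminus_list_in_sums,
       rule sum_class_eqI, simp_all add: splice_in_sums uminus_list_in_sums)
  assume "Y \<in> R_carrier H"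
  then obtain y where y: "y \<in> sums H" "Y = sum_class H y" by (rule R_carrier_cases)
  show "R_add H X Y = R_add H Y X"
    using x y by (simp add: R_add_class) (rule sum_class_eqI; simp add: splice_in_sums)
  assume "Z \<in> R_carrier H"
  then obtain z where z: "z \<in> sums H" "Z = sum_class H z" by (rule R_carrier_cases)
  show "R_add H (R_add H X Y) Z = R_add H X (R_add H Y Z)"
    using x y z by (simp add: R_add_class splice_in_sums) (rule sum_class_eqI; simp add: splice_in_sums)
qed

lemma rng_R_ring:
  assumes f: "carrier_semigroup H f"
  shows "rng (R_ring H f)"
proof (intro rng.intro rng_axioms.intro abelian_group_R_ring;
    simp add: R_ring_def R_mult_closed[OF f])
  fix X Y Z
  assume "X \<in> R_carrier H" "Y \<in> R_carrier H" "Z \<in> R_carrier H"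
  then obtain x y z where
    [simp]: "x \<in> sums H" "y \<in> sums H" "z \<in> sums H"
      "X = sum_class H x" "Y = sum_class H y" "Z = sum_class H z"
    by (metis R_carrier_cases)
  note [simp] = f R_add_class R_mult_class splice_in_sums mult_list_in_sums
  show "R_mult H f (R_mult H f X Y) Z = R_mult H f X (R_mult H f Y Z)"
    \<comment> \<open>Unfolding the double sums is blocked so that the associativity lemma matches
      them as they stand.\<close>
    by (simp del: signed_eval_mult_list)
      (rule sum_class_eqI; simp add: signed_eval_mult_list_assoc[OF f] del: signed_eval_mult_list)
  \<comment> \<open>Here the splice is the argument of the outer evaluation, so
    \<open>signed_eval_splice\<close> alone splits it.\<close>
  show "R_mult H f (R_add H X Y) Z = R_add H (R_mult H f X Z) (R_mult H f Y Z)"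
    by simp (rule sum_class_eqI; simp)
  show "R_mult H f Z (R_add H X Y) = R_add H (R_mult H f Z X) (R_mult H f Z Y)"
    by simp (rule sum_class_eqI; simp add: signed_eval_add)
qed

theorem proposition1p3:
  fixes H :: "'a set" and f :: "'a \<Rightarrow> 'a \<Rightarrow> 'a"
  assumes "carrier_semigroup H f" and "H \<noteq> {}"
  shows "congruent2 (cong_sums H) (cong_sums H) (add_rep H)
    \<and> congruent2 (cong_sums H) (cong_sums H) (mult_rep H f)
    \<and> R_add H \<in> R_carrier H \<rightarrow> R_carrier H \<rightarrow> R_carrier H
    \<and> R_mult H f \<in> R_carrier H \<rightarrow> R_carrier H \<rightarrow> R_carrier H
    \<and> rng (R_ring H f)"
  using assms congruent2_add_rep congruent2_mult_rep R_add_closed R_mult_closed rng_R_ring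
  by blast

end
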